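(* For every $n\ge 2$, the map $T\mapsto \alpha(T)$ sending a rooted duplication tree to its canonical reduction sequence is a bijection $\mathrm{RDT}_n\to \mathrm{tI}_{n-1}$.
   Context: $2$-increasing $2$-ascent sequences. For a sequence $\alpha=a_1\ldots a_N$ of nonnegative integers, an index $k\in\{1,\dots,N-1\}$ is a $2$-ascent if $a_{k+1}>a_k-2$. $\alpha$ is a $2$-ascent sequence if $a_1=0$ and $a_{k+1}\le 1+(\text{number of }2\text{-ascents of }a_1\ldots a_k)$ for all $k\in\{1,\dots,N-1\}$; it is $2$-increasing if $a_{k+1}>a_k-2$ for all $1\le k<N$. $\mathrm{tI}_N$ is the set of $2$-increasing $2$-ascent sequences of length $N$. Trees. We consider binary trees with a distinguished root edge $R$ (every non-leaf vertex has degree 3; the parent of a vertex is taken with respect to $R$) whose leaves are bijectively labelled by $[n]=\{1,\dots,n\}$ for some $n$; trees are identified up to isomorphism preserving $R$ and leaf labels. Two leaves that are siblings (children of the same parent vertex) are called a leaf pair. For such a tree $T$ with $n$ leaves and integers $a\ge 0$, $1\le r\le n-a$, the tree $\phi_{a,r}(T)$ with $n+r$ leaves is obtained by: (1) renumbering each leaf $\ell\in[n-a+1,n]$ as $\ell+r$; (2) making each leaf $\ell\in[n-a-r+1,n-a]$ the parent of a leaf pair labelled $\{\ell,\ell+r\}$. The set $\mathrm{RDT}$ of rooted duplication trees is defined inductively: the tree $T_2$ consisting of just the edge $R$ with its two endpoints being leaves labelled $1$ and $2$ is in $\mathrm{RDT}$, and if $T\in \mathrm{RDT}$ has $n$ leaves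 then $\phi_{a,r}(T)\in \mathrm{RDT}$ for all $a\ge 0$ and $1\le r\le n-a$. $\mathrm{RDT}_n$ is the set of $T\in\mathrm{RDT}$ with $n$ leaves. Canonical reduction. $T$ contains a visible $(a,r)$-duplication event if there is a tree $T'$ with $\phi_{a,r}(T')=T$; if $T$ has $n$ leaves this is equivalent to $\{\ell,\ell-r\}$ being leaf pairs of $T$ for all $\ell\in[n-a-r+1,n-a]$. Here $a$ determines $r$. The leftmost visible duplication event of $T$ is the one with largest $a$. For $T_k\in \mathrm{RDT}_k$ with $k\ge 3$ and leftmost visible duplication event having parameters $(a,r)=(a_k,r_k)$, the canonical $(a,r)$-reduction $T_{k-1}=\psi_{a,r}(T_k)\in \mathrm{RDT}_{k-1}$ is obtained by: (1) removing the leaf pair $\{k-a,k-a-r\}$ and labelling its parent $k-a$; (2) relabelling each leaf $\ell>k-a-r$ as $\ell-1$. The canonical reduction history of $T\in \mathrm{RDT}_n$ is the resulting sequence $T=T_n,T_{n-1},\dots,T_2$, and the canonical reduction sequence of $T$ is $\alpha(T)=(a_2,a_3,\dots,a_n)$ where $a_2:=0$ and $a_k$ ($k\ge 3$) is the first parameter of the leftmost visible duplication event of $T_k$. *)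

theory Defs
  imports Main "HOL-Library.Multiset" "HOL-Library.Uprod"
begin

text \<open>A sequence \<open>a\<^sub>1 \<dots> a\<^sub>N\<close> is the list \<open>xs\<close> with \<open>a\<^sub>k = xs ! (k - 1)\<close>, so that
  \<open>take k xs\<close> is \<open>a\<^sub>1 \<dots> a\<^sub>k\<close> and \<open>xs ! k\<close> is \<open>a\<^sub>k\<^sub>+\<^sub>1\<close>.  The comparison with \<open>a\<^sub>k - 2\<close> takes
  place in the integers, as subtraction on the naturals would truncate.\<close>

definition is_2_ascent :: "nat list \<Rightarrow> nat \<Rightarrow> bool" where
  "is_2_ascent xs k \<longleftrightarrow>
     1 \<le> k \<and> k < length xs \<and> int (xs ! k) > int (xs ! (k - 1)) - 2"

definition num_2_ascents :: "nat list \<Rightarrow> nat" where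
  "num_2_ascents xs = card {k. is_2_ascent xs k}"

definition two_ascent_sequence :: "nat list \<Rightarrow> bool" where
  "two_ascent_sequence xs \<longleftrightarrow>
     xs \<noteq> [] \<and> xs ! 0 = 0 \<and>
     (\<forall>k. 1 \<le> k \<and> k < length xs \<longrightarrow> xs ! k \<le> 1 + num_2_ascents (take k xs))"

definition two_increasing :: "nat list \<Rightarrow> bool" where
  "two_increasing xs \<longleftrightarrow> (\<forall>k. 1 \<le> k \<and> k < length xs \<longrightarrow> is_2_ascent xs k)"

definition tI :: "nat \<Rightarrow> nat list set" where
  "tI N = {xs. length xs = N \<and> two_ascent_sequence xs \<and> two_increasing xs}"

text \<open>Children are kept in unordered pairs, so that equality of these objects is exactly
  isomorphism of leaf-labelled trees.  A \<open>half_tree\<close> is the part of a tree hanging from one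
  end of an edge; a tree with a distinguished root edge is the unordered pair of the two
  half trees at the ends of that edge.  Thus every \<open>Branch\<close> is a vertex of degree 3, and
  the ends of the root edge have no parent: in particular two leaves that are the ends of the
  root edge are not siblings.\<close>

datatype half_tree = Leaf nat | Branch "half_tree uprod"

type_synonym tree = "half_tree uprod"

lift_definition mset_uprod :: "'a uprod \<Rightarrow> 'a multiset" is "\<lambda>(x, y). {#x, y#}"
  by (auto simp: eq_upair_def)

lemma mset_uprod_Upair [simp]: "mset_uprod (Upair x y) = {#x, y#}"
  by transfer simp

primrec half_leaves :: "half_tree \<Rightarrow> nat multiset" where
  "half_leaves (Leaf l) = {#l#}"
| "half_leaves (Branch p) = \<Sum>\<^sub># (mset_uprod (map_uprod half_leaves p))"

definition leaves :: "tree \<Rightarrow> nat multiset" where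
  "leaves T = \<Sum>\<^sub># (mset_uprod (map_uprod half_leaves T))"

abbreviation num_leaves :: "tree \<Rightarrow> nat" where
  "num_leaves T \<equiv> size (leaves T)"

definition labelled_tree :: "tree \<Rightarrow> bool" where
  "labelled_tree T \<longleftrightarrow> leaves T = mset_set {1..num_leaves T}"

primrec half_subst :: "(nat \<Rightarrow> half_tree) \<Rightarrow> half_tree \<Rightarrow> half_tree" where
  "half_subst f (Leaf l) = f l"
| "half_subst f (Branch p) = Branch (map_uprod (half_subst f) p)"

definition subst_leaves :: "(nat \<Rightarrow> half_tree) \<Rightarrow> tree \<Rightarrow> tree" where
  "subst_leaves f T = map_uprod (half_subst f) T"

text \<open>Only meaningful for \<open>1 \<le> r\<close> and \<open>a + r \<le> num_leaves T\<close>.\<close>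

definition duplicate :: "nat \<Rightarrow> nat \<Rightarrow> tree \<Rightarrow> tree" where
  "duplicate a r T =
     (let n = num_leaves T in
      subst_leaves
        (\<lambda>l. if n - a + 1 \<le> l \<and> l \<le> n then Leaf (l + r)
             else if n - a - r + 1 \<le> l \<and> l \<le> n - a
               then Branch (Upair (Leaf l) (Leaf (l + r)))
             else Leaf l)
        T)"

inductive_set RDT :: "tree set" where
  base: "Upair (Leaf 1) (Leaf 2) \<in> RDT"
| step: "T \<in> RDT \<Longrightarrow> 1 \<le> r \<Longrightarrow> a + r \<le> num_leaves T \<Longrightarrow> duplicate a r T \<in> RDT"

definition RDT_n :: "nat \<Rightarrow> tree set" where
  "RDT_n n = {T \<in> RDT. num_leaves T = n}"

definition visible_duplication :: "nat \<Rightarrow> nat \<Rightarrow> tree \<Rightarrow> bool" where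
  "visible_duplication a r T \<longleftrightarrow>
     (\<exists>T'. labelled_tree T' \<and> 1 \<le> r \<and> a + r \<le> num_leaves T' \<and> duplicate a r T' = T)"

definition leftmost_a :: "tree \<Rightarrow> nat" where
  "leftmost_a T = (GREATEST a. \<exists>r. visible_duplication a r T)"

text \<open>The first parameter of a visible duplication event determines the second.\<close>

definition leftmost_r :: "tree \<Rightarrow> nat" where
  "leftmost_r T = (THE r. visible_duplication (leftmost_a T) r T)"

primrec half_prune :: "nat \<Rightarrow> nat \<Rightarrow> half_tree \<Rightarrow> half_tree" where
  "half_prune i j (Leaf l) = Leaf l"
| "half_prune i j (Branch p) =
     (if p = Upair (Leaf i) (Leaf j) then Leaf j else Branch (map_uprod (half_prune i j) p))"

definition reduction :: "nat \<Rightarrow> nat \<Rightarrow> tree \<Rightarrow> tree" where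
  "reduction a r T =
     (let k = num_leaves T in
      subst_leaves (\<lambda>l. Leaf (if l > k - a - r then l - 1 else l))
        (map_uprod (half_prune (k - a - r) (k - a)) T))"

definition canonical_reduction :: "tree \<Rightarrow> tree" where
  "canonical_reduction T = reduction (leftmost_a T) (leftmost_r T) T"

text \<open>The tree \<open>T\<^sub>k\<close> of the canonical reduction history \<open>T = T\<^sub>n, \<dots>, T\<^sub>2\<close> of \<open>T\<close>.\<close>

definition canonical_history :: "tree \<Rightarrow> nat \<Rightarrow> tree" where
  "canonical_history T k = (canonical_reduction ^^ (num_leaves T - k)) T"

definition canonical_reduction_sequence :: "tree \<Rightarrow> nat list" where
  "canonical_reduction_sequence T =
     map (\<lambda>k. if k = 2 then 0 else leftmost_a (canonical_history T k)) [2..<num_leaves T + 1]"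

end

theory Submission
  imports Defs
begin

text \<open>
  Write \<open>\<phi>\<^sub>a\<^sub>,\<^sub>r\<close> for duplication. One canonical reduction takes \<open>\<phi>\<^sub>a\<^sub>,\<^sub>r\<^sub>+\<^sub>1(T')\<close> to \<open>\<phi>\<^sub>a\<^sub>+\<^sub>1\<^sub>,\<^sub>r(T')\<close>, where
  \<open>\<phi>\<^sub>a\<^sub>,\<^sub>0\<close> is the identity (\<open>reduction_duplicate\<close>): an event is undone one leaf at a time. In a
  2-increasing sequence every index is a 2-ascent, so the sequences in question are those with
  \<open>a\<^sub>2 = 0\<close>, \<open>a\<^sub>k \<le> k - 2\<close> and \<open>a\<^sub>k\<^sub>-\<^sub>1 \<le> a\<^sub>k + 1\<close> for \<open>k \<ge> 3\<close>. By induction on the number of leaves it therefore suffices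
  that, for \<open>k \<ge> 3\<close>, the map \<open>T\<^sub>k \<mapsto> (T\<^sub>k\<^sub>-\<^sub>1, a\<^sub>k)\<close> is a bijection onto the pairs \<open>(S, a)\<close> of a
  rooted duplication tree \<open>S\<close> with \<open>k - 1\<close> leaves and a number \<open>a \<le> k - 2\<close> such that all events visible in \<open>S\<close> have first
  parameter at most \<open>a + 1\<close>.

  A visible event is a run of leaf pairs \<open>{l - r, l}\<close> (\<open>visible_duplication_iff_cherry_run\<close>). As a leaf
  has only one sibling, the blocks of different events of a tree are disjoint
  (\<open>cherry_runs_disjoint\<close>). This has two consequences. Firstly, different events commute, whence
  undoing any visible event of a rooted duplication tree gives a rooted duplication tree
  (\<open>duplicate_in_RDT_D\<close>). Secondly, the events left of a duplicated block are the same, up to a shift of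
  the first parameter, before and after that duplication (\<open>cherry_run_duplicate_low_iff\<close>), so that
  the trees \<open>T'\<close>, \<open>\<phi>\<^sub>a\<^sub>+\<^sub>1\<^sub>,\<^sub>r(T')\<close> and \<open>\<phi>\<^sub>a\<^sub>,\<^sub>r\<^sub>+\<^sub>1(T')\<close> can be compared.

  The comparison gives the bound \<open>a\<^sub>k\<^sub>-\<^sub>1 \<le> a\<^sub>k + 1\<close> (\<open>canonical_reduction_RDT\<close>). It also shows how to go
  back from \<open>(S, a)\<close>: if \<open>S = \<phi>\<^sub>a\<^sub>+\<^sub>1\<^sub>,\<^sub>r(T')\<close> shows an event with parameter \<open>a + 1\<close>, take \<open>\<phi>\<^sub>a\<^sub>,\<^sub>r\<^sub>+\<^sub>1(T')\<close>, and
  otherwise \<open>\<phi>\<^sub>a\<^sub>,\<^sub>1(S)\<close> (\<open>canonical_reduction_surj\<close>). No other tree is possible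
  (\<open>canonical_reduction_inj\<close>).
\<close>

section \<open>Substitution for leaves\<close>

lemma half_tree_induct [case_names Leaf Branch]:
  assumes "\<And>l. P (Leaf l)" and "\<And>x y. P x \<Longrightarrow> P y \<Longrightarrow> P (Branch (Upair x y))"
  shows "P t"
proof (induction t)
  case (Branch p)
  then show ?case by (cases p) (auto intro: assms(2))
qed (rule assms(1))

lemma half_subst_half_subst:
  "half_subst g (half_subst f t) = half_subst (\<lambda>l. half_subst g (f l)) t"
  by (induction t rule: half_tree_induct) auto

lemma subst_leaves_subst_leaves:
  "subst_leaves g (subst_leaves f T) = subst_leaves (\<lambda>l. half_subst g (f l)) T"
  by (cases T) (auto simp: subst_leaves_def half_subst_half_subst)

lemma half_subst_cong:
  "(\<And>l. l \<in># half_leaves t \<Longrightarrow> f l = g l) \<Longrightarrow> half_subst f t = half_subst g t"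
  by (induction t rule: half_tree_induct) auto

lemma subst_leaves_cong:
  "(\<And>l. l \<in># leaves T \<Longrightarrow> f l = g l) \<Longrightarrow> subst_leaves f T = subst_leaves g T"
  by (cases T) (auto simp: subst_leaves_def leaves_def intro: half_subst_cong)

lemma half_subst_Leaf: "half_subst Leaf t = t"
  by (induction t rule: half_tree_induct) auto

lemma subst_leaves_Leaf: "subst_leaves Leaf T = T"
  by (cases T) (auto simp: subst_leaves_def half_subst_Leaf)

lemma half_leaves_half_subst:
  "half_leaves (half_subst f t) = (\<Sum>l\<in>#half_leaves t. half_leaves (f l))"
  by (induction t rule: half_tree_induct) auto

lemma leaves_subst_leaves:
  "leaves (subst_leaves f T) = (\<Sum>l\<in>#leaves T. half_leaves (f l))"
  by (cases T) (auto simp: subst_leaves_def leaves_def half_leaves_half_subst)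

lemma labelled_tree_leaf_iff:
  "labelled_tree T \<Longrightarrow> l \<in># leaves T \<longleftrightarrow> 1 \<le> l \<and> l \<le> num_leaves T"
  by (metis labelled_tree_def atLeastAtMost_iff elem_mset_set finite_atLeastAtMost)

lemma labelled_tree_count_le_1:
  "labelled_tree T \<Longrightarrow> count (leaves T) l \<le> 1"
  by (metis labelled_tree_def count_mset_set' order_refl zero_le_one)

section \<open>Leaf pairs\<close>

text \<open>A leaf pair is stored as the unordered pair of its labels. The two ends of the root edge are
  not siblings, so \<open>cherries\<close> collects the leaf pairs of the two half trees only.\<close>

primrec half_cherries :: "half_tree \<Rightarrow> nat uprod set" where
  "half_cherries (Leaf l) = {}"
| "half_cherries (Branch p) =
     {q. p = map_uprod Leaf q} \<union> \<Union> (set_uprod (map_uprod half_cherries p))"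

definition cherries :: "tree \<Rightarrow> nat uprod set" where
  "cherries T = \<Union> (half_cherries ` set_uprod T)"

lemma half_cherry_in_leaves:
  "Upair i j \<in> half_cherries t \<Longrightarrow> {#i, j#} \<subseteq># half_leaves t"
proof (induction t rule: half_tree_induct)
  case (Branch x y)
  then show ?case by (auto intro: subset_mset.add_increasing subset_mset.add_increasing2)
qed auto

lemma half_cherry_leaf: "q \<in> half_cherries t \<Longrightarrow> m \<in> set_uprod q \<Longrightarrow> m \<in># half_leaves t"
  by (cases q) (auto dest!: half_cherry_in_leaves dest: mset_subset_eqD)

lemma cherry_leaf: "q \<in> cherries T \<Longrightarrow> m \<in> set_uprod q \<Longrightarrow> m \<in># leaves T"
  by (cases T) (auto simp: cherries_def leaves_def dest: half_cherry_leaf)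

lemma count_sum_le_1_D:
  assumes "\<And>m. count (M + N) m \<le> (1::nat)"
  shows "count M m \<le> 1" "count N m \<le> 1" "m \<in># M \<Longrightarrow> m \<notin># N"
  using assms[of m] by (auto simp flip: count_greater_zero_iff simp: not_in_iff)

text \<open>With distinct labels a leaf lies in only one of the two halves of a branch, so all pairs that
  contain it come from the same half.\<close>

lemma half_cherry_partner_unique:
  assumes "\<And>m. count (half_leaves t) m \<le> 1"
    and "Upair i j \<in> half_cherries t" and "Upair i j' \<in> half_cherries t"
  shows "j = j'"
  using assms
proof (induction t rule: half_tree_induct)
  case (Branch x y)
  have le: "count (half_leaves x + half_leaves y) m \<le> 1" for m
    using Branch.prems(1)[of m] by simp
  note D = count_sum_le_1_D[OF le]
  have dis: "False" if "Upair i k \<in> half_cherries x" "Upair i k' \<in> half_cherries y" for k k'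
    using half_cherry_leaf[OF that(1), of i] half_cherry_leaf[OF that(2), of i] D(3)[of i] by auto
  have IH: "Upair i j \<in> half_cherries x \<Longrightarrow> Upair i j' \<in> half_cherries x \<Longrightarrow> j = j'"
     "Upair i j \<in> half_cherries y \<Longrightarrow> Upair i j' \<in> half_cherries y \<Longrightarrow> j = j'"
    using Branch.IH D(1,2) by blast+
  show ?case using Branch.prems(2,3) dis IH by auto
qed auto

lemma cherry_partner_unique:
  assumes "labelled_tree T" "Upair i j \<in> cherries T" "Upair i j' \<in> cherries T"
  shows "j = j'"
proof (cases T)
  case (Upair x y)
  have le: "count (half_leaves x + half_leaves y) m \<le> 1" for m
    using labelled_tree_count_le_1[OF assms(1), of m] by (simp add: Upair leaves_def)
  note D = count_sum_le_1_D[OF le]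
  have dis: "False" if "Upair i k \<in> half_cherries x" "Upair i k' \<in> half_cherries y" for k k'
    using half_cherry_leaf[OF that(1), of i] half_cherry_leaf[OF that(2), of i] D(3)[of i] by auto
  show ?thesis
    using assms(2,3) dis half_cherry_partner_unique[OF D(1), of i j j']
      half_cherry_partner_unique[OF D(2), of i j j'] by (auto simp: Upair cherries_def)
qed

lemma half_subst_eq_Leaf_iff: "half_subst f t = Leaf m \<longleftrightarrow> (\<exists>l. t = Leaf l \<and> f l = Leaf m)"
  by (cases t) auto

text \<open>A leaf pair of the substituted tree either lies inside the tree that replaces some leaf, or
  arises from a leaf pair both of whose leaves are replaced by leaves.\<close>

lemma half_cherries_half_subst:
  "q \<in> half_cherries (half_subst f t) \<longleftrightarrow>
     (\<exists>l\<in>#half_leaves t. q \<in> half_cherries (f l)) \<or>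
     (\<exists>p\<in>half_cherries t. map_uprod f p = map_uprod Leaf q)"
proof (induction t rule: half_tree_induct)
  case (Branch x y)
  have "map_uprod (half_subst f) (Upair x y) = map_uprod Leaf q \<longleftrightarrow>
      (\<exists>p. Upair x y = map_uprod Leaf p \<and> map_uprod f p = map_uprod Leaf q)" (is "?L = ?R")
  proof
    assume ?L
    then show ?R
      by (cases q) (auto simp: half_subst_eq_Leaf_iff intro: exI[of _ "Upair _ _"])
  next
    assume ?R
    then obtain p where p: "Upair x y = map_uprod Leaf p" "map_uprod f p = map_uprod Leaf q" by blast
    show ?L using p(2) unfolding p(1) by (cases p) simp
  qed
  then show ?case by (auto simp: Branch.IH)
qed auto

lemma cherries_subst_leaves:
  "q \<in> cherries (subst_leaves f T) \<longleftrightarrow>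
     (\<exists>l\<in>#leaves T. q \<in> half_cherries (f l)) \<or>
     (\<exists>p\<in>cherries T. map_uprod f p = map_uprod Leaf q)"
  by (cases T) (auto simp: cherries_def subst_leaves_def leaves_def half_cherries_half_subst)

section \<open>Duplication and its reduction\<close>

definition dup_leaf :: "nat \<Rightarrow> nat \<Rightarrow> nat \<Rightarrow> nat \<Rightarrow> half_tree" where
  "dup_leaf n a r l =
     (if n - a + 1 \<le> l \<and> l \<le> n then Leaf (l + r)
      else if n - a - r + 1 \<le> l \<and> l \<le> n - a then Branch (Upair (Leaf l) (Leaf (l + r)))
      else Leaf l)"

lemma dup_leaf_low: "l \<le> n - a - r \<Longrightarrow> dup_leaf n a r l = Leaf l"
  and dup_leaf_mid: "n - a - r < l \<Longrightarrow> l \<le> n - a \<Longrightarrow> dup_leaf n a r l = Branch (Upair (Leaf l) (Leaf (l + r)))"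
  and dup_leaf_high: "n - a < l \<Longrightarrow> l \<le> n \<Longrightarrow> dup_leaf n a r l = Leaf (l + r)"
  by (auto simp: dup_leaf_def)

lemma duplicate_eq_subst_leaves: "duplicate a r T = subst_leaves (dup_leaf (num_leaves T) a r) T"
  by (simp add: duplicate_def dup_leaf_def[abs_def] Let_def)

text \<open>The labels \<open>{1..n}\<close> fall into those left of the duplicated block, the block itself, and those
  to its right. The first interval is kept, the last one is shifted by \<open>r\<close>, and the block gives
  both itself and a copy shifted by \<open>r\<close>, which fills the gap that the last interval leaves.\<close>

lemma sum_half_leaves_dup_leaf:
  assumes "a + r \<le> n"
  shows "(\<Sum>l\<in>#mset_set {1..n}. half_leaves (dup_leaf n a r l)) = mset_set {1..n + r}"
proof -
  let ?A = "{1..n - a - r}" and ?B = "{n - a - r + 1..n - a}" and ?C = "{n - a + 1..n}"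
  let ?S = "\<lambda>M. \<Sum>l\<in>#M. half_leaves (dup_leaf n a r l)"
  have "{1..n} = ?A \<union> (?B \<union> ?C)" using assms by auto
  then have "mset_set {1..n} = mset_set (?A \<union> (?B \<union> ?C))" by simp
  also have "\<dots> = mset_set ?A + mset_set (?B \<union> ?C)" by (rule mset_set_Union) auto
  also have "mset_set (?B \<union> ?C) = mset_set ?B + mset_set ?C" by (rule mset_set_Union) auto
  finally have split: "mset_set {1..n} = mset_set ?A + (mset_set ?B + mset_set ?C)" .
  have A: "?S (mset_set ?A) = mset_set ?A"
  proof -
    have "?S (mset_set ?A) = (\<Sum>l\<in>#mset_set ?A. {#l#})"
      by (intro arg_cong[where f = sum_mset] image_mset_cong) (use assms in \<open>auto simp: dup_leaf_def\<close>)
    then show ?thesis by simp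
  qed
  have shift: "(\<Sum>l\<in>#mset_set {i..j}. {#l + r#}) = mset_set {i + r..j + r}" for i j
  proof -
    have "(\<Sum>l\<in>#M. {#l + r#}) = image_mset (\<lambda>l. l + r) M" for M
      by (induction M) auto
    moreover have "image_mset (\<lambda>l. l + r) (mset_set {i..j}) = mset_set ((\<lambda>l. l + r) ` {i..j})"
      by (rule image_mset_mset_set) (simp add: inj_on_def)
    ultimately show ?thesis by (simp only: image_add_atLeastAtMost')
  qed
  have C: "?S (mset_set ?C) = mset_set {n - a + 1 + r..n + r}"
  proof -
    have "?S (mset_set ?C) = (\<Sum>l\<in>#mset_set ?C. {#l + r#})"
      by (intro arg_cong[where f = sum_mset] image_mset_cong) (auto simp: dup_leaf_def)
    then show ?thesis by (simp only: shift)
  qed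
  have B: "?S (mset_set ?B) = mset_set ?B + mset_set {n - a + 1 ..n - a + r}"
  proof -
    have "?S (mset_set ?B) = (\<Sum>l\<in>#mset_set ?B. {#l#} + {#l + r#})"
      by (intro arg_cong[where f = sum_mset] image_mset_cong) (auto simp: dup_leaf_def)
    also have "(\<Sum>l\<in>#M. {#l#} + {#l + r#}) = M + (\<Sum>l\<in>#M. {#l + r#})" for M
      by (induction M) auto
    also have "(\<Sum>l\<in>#mset_set ?B. {#l + r#}) = mset_set {n - a + 1 ..n - a + r}"
      using assms by (simp only: shift) simp
    finally show ?thesis .
  qed
  let ?B' = "{n - a + 1 ..n - a + r}" and ?C' = "{n - a + 1 + r..n + r}"
  have "{1..n + r} = ?A \<union> (?B \<union> (?B' \<union> ?C'))" using assms by auto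
  then have "mset_set {1..n + r} = mset_set (?A \<union> (?B \<union> (?B' \<union> ?C')))" by simp
  also have "\<dots> = mset_set ?A + mset_set (?B \<union> (?B' \<union> ?C'))" by (rule mset_set_Union) auto
  also have "mset_set (?B \<union> (?B' \<union> ?C')) = mset_set ?B + mset_set (?B' \<union> ?C')"
    by (rule mset_set_Union) auto
  also have "mset_set (?B' \<union> ?C') = mset_set ?B' + mset_set ?C'"
    by (rule mset_set_Union) auto
  finally show ?thesis by (simp only: split image_mset_union sum_mset.union A B C add.assoc)
qed

lemma
  assumes "labelled_tree T" and "a + r \<le> num_leaves T"
  shows labelled_tree_duplicate: "labelled_tree (duplicate a r T)"
    and num_leaves_duplicate: "num_leaves (duplicate a r T) = num_leaves T + r"
proof -
  have "leaves (duplicate a r T) = mset_set {1..num_leaves T + r}"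
    using sum_half_leaves_dup_leaf[OF assms(2)] assms(1)
    by (metis duplicate_eq_subst_leaves labelled_tree_def leaves_subst_leaves)
  then show "labelled_tree (duplicate a r T)" "num_leaves (duplicate a r T) = num_leaves T + r"
    by (auto simp: labelled_tree_def)
qed

text \<open>The empty duplication makes the recursion of \<open>reduction_duplicate\<close> uniform: undoing a
  duplication of \<open>r\<close> leaves takes \<open>r\<close> reductions and ends here.\<close>

lemma duplicate_0: "duplicate a 0 T = T"
proof -
  have "duplicate a 0 T = subst_leaves Leaf T"
    unfolding duplicate_eq_subst_leaves by (rule subst_leaves_cong) (auto simp: dup_leaf_def)
  then show ?thesis by (simp add: subst_leaves_Leaf)
qed

text \<open>If the leaf \<open>i\<close> arises only inside a tree that replaces a leaf, then the pair \<open>{i, j}\<close> is never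
  assembled from two substituted leaves, and pruning acts on each replacing tree separately.\<close>

lemma half_prune_half_subst:
  assumes "\<And>l. f l \<noteq> Leaf i"
  shows "half_prune i j (half_subst f t) = half_subst (\<lambda>l. half_prune i j (f l)) t"
proof (induction t rule: half_tree_induct)
  case (Branch x y)
  have "half_subst f t \<noteq> Leaf i" for t using assms by (simp add: half_subst_eq_Leaf_iff)
  then show ?case using Branch by simp
qed simp

text \<open>Removing the last of the duplicated pairs leaves a duplicated block that is one leaf shorter.
  The merged leaf now stands to the right of that block, which raises the first parameter by one.\<close>

lemma reduction_duplicate:
  assumes "labelled_tree T" and "a + Suc r \<le> num_leaves T"
  shows "reduction a (Suc r) (duplicate a (Suc r) T) = duplicate (Suc a) r T"
proof -
  let ?n = "num_leaves T" and ?f = "dup_leaf (num_leaves T) a (Suc r)"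
  let ?i = "?n - a" and ?j = "?n - a + Suc r"
  let ?h = "\<lambda>l. Leaf (if l > ?i then l - 1 else l)"
  have "?f l \<noteq> Leaf ?i" for l using assms(2) by (auto simp: dup_leaf_def)
  then have prune: "map_uprod (half_prune ?i ?j) (duplicate a (Suc r) T)
      = subst_leaves (\<lambda>l. half_prune ?i ?j (?f l)) T"
    unfolding duplicate_eq_subst_leaves
    by (cases T) (simp add: subst_leaves_def half_prune_half_subst)
  have "reduction a (Suc r) (duplicate a (Suc r) T)
      = subst_leaves ?h (map_uprod (half_prune ?i ?j) (duplicate a (Suc r) T))"
    using assms(2) by (simp add: reduction_def Let_def num_leaves_duplicate[OF assms] add.commute Suc_diff_le)
  also have "\<dots> = subst_leaves (\<lambda>l. half_subst ?h (half_prune ?i ?j (?f l))) T"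
    by (simp only: prune subst_leaves_subst_leaves)
  also have "\<dots> = subst_leaves (dup_leaf ?n (Suc a) r) T"
  proof (rule subst_leaves_cong)
    fix l assume "l \<in># leaves T"
    then have "1 \<le> l" "l \<le> ?n" using labelled_tree_leaf_iff[OF assms(1)] by auto
    then show "half_subst ?h (half_prune ?i ?j (?f l)) = dup_leaf ?n (Suc a) r l"
      using assms(2) by (auto simp: dup_leaf_def)
  qed
  finally show ?thesis by (simp add: duplicate_eq_subst_leaves)
qed

text \<open>The duplicated tree is recovered by \<open>r\<close> reductions.\<close>

lemma duplicate_inject:
  assumes "labelled_tree T" "labelled_tree T'" "a + r \<le> num_leaves T" "a + r \<le> num_leaves T'"
    and "duplicate a r T = duplicate a r T'"
  shows "T = T'"
  using assms
proof (induction r arbitrary: a)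
  case (Suc r)
  show ?case
    using Suc.IH[of "Suc a"] Suc.prems reduction_duplicate[of T a r] reduction_duplicate[of T' a r]
    by simp
qed (simp add: duplicate_0)

section \<open>Visible duplication events as runs of leaf pairs\<close>

lemma cherry_duplicate_low_iff:
  assumes "a + r \<le> num_leaves T" and "i \<le> num_leaves T - a - r" and "j \<le> num_leaves T - a - r"
  shows "Upair i j \<in> cherries (duplicate a r T) \<longleftrightarrow> Upair i j \<in> cherries T"
proof -
  let ?f = "dup_leaf (num_leaves T) a r"
  have leaf: "?f l = Leaf m \<longleftrightarrow> l = m" if "m \<le> num_leaves T - a - r" for l m
    using that assms(1) by (auto simp: dup_leaf_def)
  have "Upair i j \<notin> half_cherries (?f l)" for l
    using assms by (auto simp: dup_leaf_def)
  moreover have "map_uprod ?f p = map_uprod Leaf (Upair i j) \<longleftrightarrow> p = Upair i j" for p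
    using leaf[OF assms(2)] leaf[OF assms(3)] by (cases p) auto
  ultimately show ?thesis
    unfolding duplicate_eq_subst_leaves cherries_subst_leaves by auto
qed

lemma cherry_duplicate_highD:
  assumes T: "labelled_tree T" and "a + r \<le> num_leaves T" and "num_leaves T - a < i" and "num_leaves T - a < j"
    and "Upair (i + r) (j + r) \<in> cherries (duplicate a r T)"
  shows "Upair i j \<in> cherries T"
proof -
  let ?f = "dup_leaf (num_leaves T) a r"
  have leaf: "l = m" if "?f l = Leaf (m + r)" "l \<le> num_leaves T" "num_leaves T - a < m" for l m
    using that by (auto simp: dup_leaf_def split: if_splits)
  have "Upair (i + r) (j + r) \<notin> half_cherries (?f l)" for l
    using assms by (auto simp: dup_leaf_def)
  then obtain p where p: "p \<in> cherries T" "map_uprod ?f p = map_uprod Leaf (Upair (i + r) (j + r))"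
    using assms(5) unfolding duplicate_eq_subst_leaves cherries_subst_leaves by blast
  obtain l m where lm: "p = Upair l m" "?f l = Leaf (i + r)" "?f m = Leaf (j + r)"
    using p(2) by (cases p) auto
  have "l \<le> num_leaves T" "m \<le> num_leaves T"
    using cherry_leaf[OF p(1)] labelled_tree_leaf_iff[OF T] by (auto simp: lm)
  then show ?thesis using leaf lm p(1) assms(3,4) by metis
qed

text \<open>The criterion for a visible \<open>(a, r)\<close>-duplication event in terms of leaf pairs, which
  \<open>visible_duplication_iff_cherry_run\<close> confirms. The bound on \<open>a + 2 * r\<close> makes room for the block
  and its copy, and rules out that \<open>l - r\<close> is truncated.\<close>

definition cherry_run :: "nat \<Rightarrow> nat \<Rightarrow> tree \<Rightarrow> bool" where
  "cherry_run a r T \<longleftrightarrow>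
     1 \<le> r \<and> a + 2 * r \<le> num_leaves T \<and>
     (\<forall>l. num_leaves T - a - r < l \<and> l \<le> num_leaves T - a \<longrightarrow> Upair (l - r) l \<in> cherries T)"

lemma cherry_runD:
  "cherry_run a r T \<Longrightarrow> num_leaves T - a - r < l \<Longrightarrow> l \<le> num_leaves T - a \<Longrightarrow> Upair (l - r) l \<in> cherries T"
  by (simp add: cherry_run_def)

lemma cherry_runD':
  assumes "cherry_run a r T" "num_leaves T - a - r < l" "l \<le> num_leaves T - a"
  shows "Upair l (l - r) \<in> cherries T"
proof -
  have eq: "Upair l (l - r) = Upair (l - r) l" by simp
  show ?thesis unfolding eq by (rule cherry_runD[OF assms])
qed

lemma cherry_run_bounds: "cherry_run a r T \<Longrightarrow> 1 \<le> r \<and> a + 2 * r \<le> num_leaves T"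
  by (simp add: cherry_run_def)

lemma cherry_run_duplicate:
  assumes "labelled_tree T" "1 \<le> r" "a + r \<le> num_leaves T"
  shows "cherry_run a r (duplicate a r T)"
  unfolding cherry_run_def num_leaves_duplicate[OF assms(1,3)]
proof (intro conjI allI impI)
  fix l assume l: "num_leaves T + r - a - r < l \<and> l \<le> num_leaves T + r - a"
  define m where "m = l - r"
  have m: "num_leaves T - a - r < m" "m \<le> num_leaves T - a" "l = m + r" "1 \<le> m" "m \<le> num_leaves T"
    unfolding m_def using l assms(2,3) by linarith+
  have "Upair m l \<in> half_cherries (dup_leaf (num_leaves T) a r m)"
    using dup_leaf_mid[OF m(1,2)] by (auto simp: m(3) intro: exI[of _ "Upair _ _"])
  moreover have "m \<in># leaves T" using m(4,5) labelled_tree_leaf_iff[OF assms(1)] by blast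
  ultimately show "Upair (l - r) l \<in> cherries (duplicate a r T)"
    unfolding duplicate_eq_subst_leaves cherries_subst_leaves m_def by blast
qed (use assms in auto)

text \<open>A tree is in the image of the substitution \<open>f\<close> as soon as each of its leaves is accounted for:
  it is the replacement of a leaf, or belongs to a leaf pair that is. Distinctness of the labels
  ensures that the leaf pairs accounting for the leaves of one half lie in that half.\<close>

lemma half_tree_parse:
  assumes "\<And>m. count (half_leaves t) m \<le> 1"
    and "\<And>m. m \<in># half_leaves t \<Longrightarrow> (\<exists>l\<in>A. f l = Leaf m) \<or>
      (\<exists>l\<in>A. \<exists>p\<in>half_cherries t. m \<in> set_uprod p \<and> f l = Branch (map_uprod Leaf p))"
  shows "\<exists>t'. set_mset (half_leaves t') \<subseteq> A \<and> half_subst f t' = t"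
  using assms
proof (induction t rule: half_tree_induct)
  case (Leaf l)
  then obtain l' where "l' \<in> A" "f l' = Leaf l" by auto
  then show ?case by (intro exI[of _ "Leaf l'"]) auto
next
  case (Branch x y)
  show ?case
  proof (cases "\<exists>l\<in>A. f l = Branch (Upair x y)")
    case True
    then obtain l where "l \<in> A" "f l = Branch (Upair x y)" by blast
    then show ?thesis by (intro exI[of _ "Leaf l"]) auto
  next
    case False
    have le: "count (half_leaves x + half_leaves y) m \<le> 1" for m
      using Branch.prems(1)[of m] by simp
    note D = count_sum_le_1_D[OF le]
    have "\<exists>t'. set_mset (half_leaves t') \<subseteq> A \<and> half_subst f t' = x"
    proof (rule Branch.IH(1)[OF D(1)])
      fix m assume m: "m \<in># half_leaves x"
      then show "(\<exists>l\<in>A. f l = Leaf m) \<or>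
        (\<exists>l\<in>A. \<exists>p\<in>half_cherries x. m \<in> set_uprod p \<and> f l = Branch (map_uprod Leaf p))"
        using Branch.prems(2)[of m] False D(3)[OF m] half_cherry_leaf by fastforce
    qed
    moreover have "\<exists>t'. set_mset (half_leaves t') \<subseteq> A \<and> half_subst f t' = y"
    proof (rule Branch.IH(2)[OF D(2)])
      fix m assume m: "m \<in># half_leaves y"
      then show "(\<exists>l\<in>A. f l = Leaf m) \<or>
        (\<exists>l\<in>A. \<exists>p\<in>half_cherries y. m \<in> set_uprod p \<and> f l = Branch (map_uprod Leaf p))"
        using Branch.prems(2)[of m] False D(3)[of m] half_cherry_leaf by fastforce
    qed
    ultimately obtain x' y' where "set_mset (half_leaves x') \<subseteq> A" "half_subst f x' = x"
      "set_mset (half_leaves y') \<subseteq> A" "half_subst f y' = y" by blast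
    then show ?thesis by (intro exI[of _ "Branch (Upair x' y')"]) auto
  qed
qed

lemma tree_parse:
  assumes "labelled_tree T"
    and "\<And>m. m \<in># leaves T \<Longrightarrow> (\<exists>l\<in>A. f l = Leaf m) \<or>
      (\<exists>l\<in>A. \<exists>p\<in>cherries T. m \<in> set_uprod p \<and> f l = Branch (map_uprod Leaf p))"
  shows "\<exists>T'. set_mset (leaves T') \<subseteq> A \<and> subst_leaves f T' = T"
proof (cases T)
  case (Upair x y)
  have le: "count (half_leaves x + half_leaves y) m \<le> 1" for m
    using labelled_tree_count_le_1[OF assms(1), of m] by (simp add: Upair leaves_def)
  note D = count_sum_le_1_D[OF le]
  note m = assms(2)[unfolded Upair leaves_def cherries_def]
  have "\<exists>t'. set_mset (half_leaves t') \<subseteq> A \<and> half_subst f t' = x"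
  proof (rule half_tree_parse[OF D(1)])
    fix m assume "m \<in># half_leaves x"
    then show "(\<exists>l\<in>A. f l = Leaf m) \<or>
        (\<exists>l\<in>A. \<exists>p\<in>half_cherries x. m \<in> set_uprod p \<and> f l = Branch (map_uprod Leaf p))"
      using m[of m] D(3)[of m] half_cherry_leaf by fastforce
  qed
  moreover have "\<exists>t'. set_mset (half_leaves t') \<subseteq> A \<and> half_subst f t' = y"
  proof (rule half_tree_parse[OF D(2)])
    fix m assume "m \<in># half_leaves y"
    then show "(\<exists>l\<in>A. f l = Leaf m) \<or>
        (\<exists>l\<in>A. \<exists>p\<in>half_cherries y. m \<in> set_uprod p \<and> f l = Branch (map_uprod Leaf p))"
      using m[of m] D(3)[of m] half_cherry_leaf by fastforce
  qed
  ultimately obtain x' y' where "set_mset (half_leaves x') \<subseteq> A" "half_subst f x' = x"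
    "set_mset (half_leaves y') \<subseteq> A" "half_subst f y' = y" by blast
  then show ?thesis
    by (intro exI[of _ "Upair x' y'"]) (auto simp: Upair subst_leaves_def leaves_def)
qed

text \<open>Each leaf \<open>l\<close> leaves a mark that no other leaf produces, namely the smallest label in the tree
  that replaces it. Hence the leaves of a tree can be recovered from those of its duplicate.\<close>

lemma count_sum_half_leaves_dup_leaf:
  assumes "a + r \<le> n" and "set_mset M \<subseteq> {1..n}" and "l \<in> {1..n}"
  shows "count (\<Sum>l\<in>#M. half_leaves (dup_leaf n a r l)) (if l \<le> n - a then l else l + r) = count M l"
  using assms(2)
proof (induction M)
  case (add x M)
  have "count (half_leaves (dup_leaf n a r x)) (if l \<le> n - a then l else l + r) = (if x = l then 1 else 0)"
    using add.prems assms(1,3) by (auto simp: dup_leaf_def)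
  then show ?case using add by auto
qed simp

lemma cherry_run_obtains:
  assumes T: "labelled_tree T" and run: "cherry_run a r T"
  obtains T' where "labelled_tree T'" "a + r \<le> num_leaves T'" "duplicate a r T' = T"
proof -
  define n where "n = num_leaves T - r"
  let ?f = "dup_leaf n a r"
  have bounds: "1 \<le> r" "a + r \<le> n" and nT: "num_leaves T = n + r"
    using cherry_run_bounds[OF run] by (auto simp: n_def)
  have "\<exists>T'. set_mset (leaves T') \<subseteq> {1..n} \<and> subst_leaves ?f T' = T"
  proof (rule tree_parse[OF T])
    fix m assume "m \<in># leaves T"
    then have m: "1 \<le> m" "m \<le> n + r" using labelled_tree_leaf_iff[OF T] nT by auto
    have pair: "\<exists>l\<in>{1..n}. \<exists>p\<in>cherries T. m \<in> set_uprod p \<and> ?f l = Branch (map_uprod Leaf p)"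
      if "n - a - r < l" "l \<le> n - a" "m = l \<or> m = l + r" for l
    proof (intro bexI conjI)
      show "Upair l (l + r) \<in> cherries T"
        using cherry_runD[OF run, of "l + r"] that bounds nT by auto
      show "?f l = Branch (map_uprod Leaf (Upair l (l + r)))" using that by (auto simp: dup_leaf_def)
    qed (use that in auto)
    consider "m \<le> n - a - r" | "n - a + r < m" | "n - a - r < m" "m \<le> n - a"
      | "n - a < m" "m \<le> n - a + r" by linarith
    then show "(\<exists>l\<in>{1..n}. ?f l = Leaf m) \<or>
        (\<exists>l\<in>{1..n}. \<exists>p\<in>cherries T. m \<in> set_uprod p \<and> ?f l = Branch (map_uprod Leaf p))"
    proof cases
      case 1
      then show ?thesis using m by (intro disjI1 bexI[of _ m]) (auto simp: dup_leaf_def)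
    next
      case 2
      then show ?thesis using m bounds by (intro disjI1 bexI[of _ "m - r"]) (auto simp: dup_leaf_def)
    next
      case 3
      then show ?thesis using pair[of m] by blast
    next
      case 4
      then show ?thesis using pair[of "m - r"] bounds by auto
    qed
  qed
  then obtain T' where T': "set_mset (leaves T') \<subseteq> {1..n}" "subst_leaves ?f T' = T" by blast
  \<comment> \<open>Both sides are the leaves of the given tree; counting marks cancels the substitution.\<close>
  have sums: "(\<Sum>l\<in>#leaves T'. half_leaves (?f l)) = (\<Sum>l\<in>#mset_set {1..n}. half_leaves (?f l))"
    using T T'(2) nT sum_half_leaves_dup_leaf[OF bounds(2)]
    by (metis labelled_tree_def leaves_subst_leaves)
  have leaves: "leaves T' = mset_set {1..n}"
  proof (rule multiset_eqI)
    fix l show "count (leaves T') l = count (mset_set {1..n}) l"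
    proof (cases "l \<in> {1..n}")
      case True
      show ?thesis
        using count_sum_half_leaves_dup_leaf[OF bounds(2) T'(1) True]
          count_sum_half_leaves_dup_leaf[OF bounds(2) _ True, of "mset_set {1..n}"] sums by simp
    next
      case False
      then show ?thesis using T'(1) by (auto simp: not_in_iff[symmetric])
    qed
  qed
  then have "num_leaves T' = n" by simp
  then show thesis
    using that[of T'] leaves T'(2) bounds by (simp add: labelled_tree_def duplicate_eq_subst_leaves)
qed

lemma visible_duplication_iff_cherry_run:
  "visible_duplication a r T \<longleftrightarrow> labelled_tree T \<and> cherry_run a r T"
proof
  assume "visible_duplication a r T"
  then show "labelled_tree T \<and> cherry_run a r T"
    using labelled_tree_duplicate cherry_run_duplicate by (auto simp: visible_duplication_def)
next
  assume *: "labelled_tree T \<and> cherry_run a r T"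
  then obtain T' where "labelled_tree T'" "a + r \<le> num_leaves T'" "duplicate a r T' = T"
    using cherry_run_obtains by blast
  then show "visible_duplication a r T"
    using cherry_run_bounds * unfolding visible_duplication_def by blast
qed

lemma cherry_run_length_unique:
  assumes "labelled_tree T" "cherry_run a r T" "cherry_run a s T"
  shows "r = s"
proof -
  let ?t = "num_leaves T - a"
  have b: "1 \<le> r" "1 \<le> s" "a + 2 * r \<le> num_leaves T" "a + 2 * s \<le> num_leaves T"
    using cherry_run_bounds[OF assms(2)] cherry_run_bounds[OF assms(3)] by auto
  have "Upair ?t (?t - r) \<in> cherries T"
    by (rule cherry_runD'[OF assms(2)]) (use b in auto)
  moreover have "Upair ?t (?t - s) \<in> cherries T"
    by (rule cherry_runD'[OF assms(3)]) (use b in auto)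
  ultimately have "?t - r = ?t - s" by (rule cherry_partner_unique[OF assms(1)])
  then show ?thesis using b by linarith
qed

text \<open>The rightmost upper leaf \<open>t\<close> of the left run has only one partner, at distance \<open>r\<close> to its left.
  If \<open>t\<close> belonged to the other run, it would be an upper leaf there, which forces equal lengths
  and then a leaf that is upper in the left run and lower in the right one; or a lower leaf there,
  and its partner would be to its right.\<close>

lemma cherry_runs_disjoint:
  assumes T: "labelled_tree T" and A: "cherry_run a r T" and B: "cherry_run b s T" and "b < a"
  shows "b + 2 * s \<le> a"
proof (rule ccontr)
  let ?k = "num_leaves T"
  define t where "t = ?k - a"
  assume "\<not> b + 2 * s \<le> a"
  have bd: "1 \<le> r" "1 \<le> s" "a + 2 * r \<le> ?k" "b + 2 * s \<le> ?k"
    using cherry_run_bounds[OF A] cherry_run_bounds[OF B] by auto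
  have t: "Upair t (t - r) \<in> cherries T"
    by (rule cherry_runD'[OF A]) (use bd in \<open>auto simp: t_def\<close>)
  have t1: "?k - b - 2 * s < t" "t < ?k - b"
    using \<open>\<not> b + 2 * s \<le> a\<close> \<open>b < a\<close> bd by (auto simp: t_def)
  show False
  proof (cases "?k - b - s < t")
    case True
    have "Upair t (t - s) \<in> cherries T"
      by (rule cherry_runD'[OF B]) (use True t1 in auto)
    from cherry_partner_unique[OF T t this] have "r = s" using bd t1 by (simp add: t_def)
    define u where "u = ?k - b - r"
    have "Upair (?k - b - s) (?k - b) \<in> cherries T"
      by (rule cherry_runD[OF B]) (use bd in auto)
    then have "Upair u (?k - b) \<in> cherries T" by (simp only: u_def \<open>r = s\<close>)
    moreover have "Upair u (u - r) \<in> cherries T"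
      by (rule cherry_runD'[OF A]) (use True \<open>b < a\<close> bd \<open>r = s\<close> in \<open>auto simp: u_def t_def\<close>)
    ultimately have "?k - b = u - r" by (rule cherry_partner_unique[OF T])
    then show False using bd by (simp add: u_def)
  next
    case False
    have "Upair (t + s - s) (t + s) \<in> cherries T"
      by (rule cherry_runD[OF B]) (use False t1 bd in auto)
    then have "Upair t (t + s) \<in> cherries T" by simp
    from cherry_partner_unique[OF T t this] show False using bd by linarith
  qed
qed

text \<open>Leaves left of the duplicated block keep their labels. As \<open>a\<close> counts the leaves to the right of
  a run, its value changes by the number \<open>r\<close> of new leaves.\<close>

lemma cherry_run_duplicate_low_iff:
  assumes "labelled_tree T" "a + r \<le> num_leaves T" "a + 2 * r \<le> b"
  shows "cherry_run b s (duplicate a r T) \<longleftrightarrow> cherry_run (b - r) s T"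
proof (cases "1 \<le> s \<and> b + 2 * s \<le> num_leaves T + r")
  case True
  have top: "num_leaves T + r - b = num_leaves T - (b - r)" using assms by auto
  have low: "Upair (l - s) l \<in> cherries (duplicate a r T) \<longleftrightarrow> Upair (l - s) l \<in> cherries T"
    if "l \<le> num_leaves T - (b - r)" for l
    by (rule cherry_duplicate_low_iff; use that assms(2,3) in linarith)
  have len: "b + 2 * s \<le> num_leaves T + r \<longleftrightarrow> b - r + 2 * s \<le> num_leaves T"
    using assms(3) by auto
  show ?thesis
    unfolding cherry_run_def num_leaves_duplicate[OF assms(1,2)] top len using low by blast
next
  case False
  then have "\<not> (1 \<le> s \<and> b - r + 2 * s \<le> num_leaves T)" using assms(3) by auto
  then show ?thesis
    using False unfolding cherry_run_def num_leaves_duplicate[OF assms(1,2)] by blast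
qed

text \<open>Leaves right of the duplicated block are shifted by \<open>s\<close> together with the total number of
  leaves, so that a run among them keeps its parameters.\<close>

lemma cherry_run_duplicate_highD:
  assumes T: "labelled_tree T" "b + s \<le> num_leaves T" and "a + 2 * r \<le> b"
    and run: "cherry_run a r (duplicate b s T)"
  shows "cherry_run a r T"
  unfolding cherry_run_def
proof (intro conjI allI impI)
  note n = num_leaves_duplicate[OF T]
  show "1 \<le> r" using cherry_run_bounds[OF run] by simp
  show "a + 2 * r \<le> num_leaves T" using assms by simp
  fix l assume l: "num_leaves T - a - r < l \<and> l \<le> num_leaves T - a"
  have "Upair (l + s - r) (l + s) \<in> cherries (duplicate b s T)"
    by (rule cherry_runD[OF run]) (use l n assms(2,3) in auto)
  moreover have "l + s - r = l - r + s" using l assms by auto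
  ultimately have "Upair (l - r + s) (l + s) \<in> cherries (duplicate b s T)" by simp
  then show "Upair (l - r) l \<in> cherries T"
    by (rule cherry_duplicate_highD[OF T, rotated 2]) (use l T(2) assms(3) in linarith)+
qed

text \<open>Duplications of disjoint blocks commute; the left one is applied with its parameter diminished
  by \<open>s\<close> if the right one has not yet created its \<open>s\<close> leaves.\<close>

lemma duplicate_commute:
  assumes U: "labelled_tree U" and ar: "a + r \<le> num_leaves U + s" and ba: "b + 2 * s \<le> a"
  shows "duplicate b s (duplicate (a - s) r U) = duplicate a r (duplicate b s U)"
proof -
  let ?n = "num_leaves U"
  have n': "num_leaves (duplicate (a - s) r U) = ?n + r" 
    by (rule num_leaves_duplicate[OF U]) (use assms in auto)
  have m: "num_leaves (duplicate b s U) = ?n + s"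
    by (rule num_leaves_duplicate[OF U]) (use assms in auto)
  have "duplicate b s (duplicate (a - s) r U) =
      subst_leaves (\<lambda>l. half_subst (dup_leaf (?n + r) b s) (dup_leaf ?n (a - s) r l)) U"
    unfolding duplicate_eq_subst_leaves[of b] n' 
    by (simp add: duplicate_eq_subst_leaves subst_leaves_subst_leaves)
  also have "\<dots> = subst_leaves (\<lambda>l. half_subst (dup_leaf (?n + s) a r) (dup_leaf ?n b s l)) U"
  proof (rule subst_leaves_cong)
    fix l assume "l \<in># leaves U"
    then have l: "1 \<le> l" "l \<le> ?n" using labelled_tree_leaf_iff[OF U] by auto
    show "half_subst (dup_leaf (?n + r) b s) (dup_leaf ?n (a - s) r l) =
        half_subst (dup_leaf (?n + s) a r) (dup_leaf ?n b s l)"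
      (is "half_subst ?B _ = half_subst ?A _")
    proof -
      \<comment> \<open>left of both blocks, in the left block, between them, in the right block, right of both\<close>
      consider "l \<le> ?n - (a - s) - r" | "?n - (a - s) - r < l" "l \<le> ?n - (a - s)"
        | "?n - (a - s) < l" "l \<le> ?n - b - s" | "?n - b - s < l" "l \<le> ?n - b" | "?n - b < l"
        by linarith
      then show ?thesis
      proof cases
        case 1
        then show ?thesis using l ar ba by (simp add: dup_leaf_low)
      next
        case 2
        then show ?thesis using l ar ba by (simp add: dup_leaf_low dup_leaf_mid)
      next
        case 3
        then show ?thesis using l ar ba by (simp add: dup_leaf_low dup_leaf_high)
      next
        case 4
        then show ?thesis using l ar ba by (simp add: dup_leaf_mid dup_leaf_high)
      next
        case 5
        then show ?thesis using l ar ba by (simp add: dup_leaf_high)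
      qed
    qed
  qed
  also have "\<dots> = duplicate a r (duplicate b s U)"
    unfolding duplicate_eq_subst_leaves[of a] m
    by (simp add: duplicate_eq_subst_leaves subst_leaves_subst_leaves)
  finally show ?thesis .
qed

section \<open>Undoing a visible duplication event inside RDT\<close>

definition base_tree :: tree where
  "base_tree = Upair (Leaf 1) (Leaf 2)"

lemma leaves_base_tree: "leaves base_tree = {#1, 2#}"
  by (simp add: leaves_def base_tree_def)

lemma num_leaves_base_tree: "num_leaves base_tree = 2"
  by (simp add: leaves_base_tree)

lemma labelled_tree_base_tree: "labelled_tree base_tree"
proof -
  have "{1..2::nat} = {1, 2}" by auto
  then show ?thesis unfolding labelled_tree_def num_leaves_base_tree by (simp add: leaves_base_tree)
qed

lemma base_tree_in_RDT: "base_tree \<in> RDT"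
  unfolding base_tree_def by (rule RDT.base)

lemma not_cherry_run_base_tree: "\<not> cherry_run a r base_tree"
proof
  assume run: "cherry_run a r base_tree"
  have "a = 0" "r = 1"
    using cherry_run_bounds[OF run] unfolding num_leaves_base_tree by linarith+
  then have "Upair (2 - 1) 2 \<in> cherries base_tree"
    using cherry_runD[OF run, of 2] unfolding num_leaves_base_tree by simp
  then show False by (simp add: cherries_def base_tree_def)
qed

lemma RDT_labelled_tree:
  assumes "T \<in> RDT"
  shows "labelled_tree T"
  using assms
proof (induction rule: RDT.induct)
  case base
  show ?case using labelled_tree_base_tree by (simp only: base_tree_def)
next
  case (step T r a)
  show ?case by (rule labelled_tree_duplicate[OF step.IH step.hyps(3)])
qed

text \<open>A diamond argument. The event to be undone differs from the last duplication of some
  construction of the tree only if its block is disjoint from the block of that duplication. Then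
  it is also visible before that duplication, where the induction hypothesis undoes it, and
  commutation rebuilds the tree in the other order.\<close>

lemma duplicate_in_RDT_D:
  assumes "T \<in> RDT" "labelled_tree T'" "1 \<le> r" "a + r \<le> num_leaves T'" "duplicate a r T' = T"
  shows "T' \<in> RDT"
  using assms
proof (induction arbitrary: a r T' rule: RDT.induct)
  case base
  then show ?case
    using cherry_run_duplicate[OF base(1-3)] not_cherry_run_base_tree by (simp only: base_tree_def)
next
  case (step S s b)
  let ?T = "duplicate b s S"
  have S: "labelled_tree S" using step.hyps(1) by (rule RDT_labelled_tree)
  have T: "labelled_tree ?T" using labelled_tree_duplicate[OF S] step.hyps by auto
  note T' = \<open>labelled_tree T'\<close> \<open>a + r \<le> num_leaves T'\<close>
  have n: "num_leaves T' + r = num_leaves S + s"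
    using num_leaves_duplicate[OF T'] num_leaves_duplicate[OF S] step.hyps step.prems by simp
  have runS: "cherry_run b s ?T"
    using cherry_run_duplicate[OF S] step.hyps by auto
  have runT': "cherry_run a r ?T"
    using cherry_run_duplicate[OF step.prems(1-3)] step.prems(4) by simp
  consider "a = b" | "b < a" | "a < b" by linarith
  then show ?case
  proof cases
    case 1
    then have "r = s" using cherry_run_length_unique[OF T, of a r s] runS runT' by simp
    then show ?thesis
      using duplicate_inject[OF T'(1) S T'(2)] step 1 n by simp
  next
    case 2
    have ba: "b + 2 * s \<le> a" by (rule cherry_runs_disjoint[OF T runT' runS 2])
    have "cherry_run (a - s) r S"
      using runT' cherry_run_duplicate_low_iff[OF S] step.hyps ba by blast
    then obtain U where U: "labelled_tree U" "a - s + r \<le> num_leaves U" "duplicate (a - s) r U = S"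
      using cherry_run_obtains[OF S] by metis
    have "U \<in> RDT" by (rule step.IH) (use U step.prems in auto)
    have bU: "b + s \<le> num_leaves U" using U(2) ba step.prems(2) by linarith
    have nb: "num_leaves (duplicate b s U) = num_leaves U + s" by (rule num_leaves_duplicate[OF U(1) bU])
    have "duplicate a r (duplicate b s U) = duplicate a r T'"
      using duplicate_commute[OF U(1), of a r s b] U(2,3) ba step.prems(4) by simp
    then have "duplicate b s U = T'"
      using duplicate_inject[OF labelled_tree_duplicate[OF U(1) bU] T'(1), of a r] nb U(2) ba T'(2) by simp
    then show ?thesis using RDT.step[OF \<open>U \<in> RDT\<close> step.hyps(2) bU] by simp
  next
    case 3
    have ab: "a + 2 * r \<le> b" by (rule cherry_runs_disjoint[OF T runS runT' 3])
    have "cherry_run a r S"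
      by (rule cherry_run_duplicate_highD[OF S step.hyps(3) ab runT'])
    then obtain U where U: "labelled_tree U" "a + r \<le> num_leaves U" "duplicate a r U = S"
      using cherry_run_obtains[OF S] by metis
    have "U \<in> RDT" by (rule step.IH) (use U step.prems in auto)
    have nU: "num_leaves S = num_leaves U + r" using num_leaves_duplicate[OF U(1,2)] U(3) by simp
    have bU: "b - r + s \<le> num_leaves U" using step.hyps(3) nU ab by linarith
    have nb: "num_leaves (duplicate (b - r) s U) = num_leaves U + s" by (rule num_leaves_duplicate[OF U(1) bU])
    have "duplicate a r (duplicate (b - r) s U) = duplicate a r T'"
      using duplicate_commute[OF U(1), of b s r a] U(3) ab step.prems(4) step.hyps(3) nU by simp
    then have "duplicate (b - r) s U = T'"
      using duplicate_inject[OF labelled_tree_duplicate[OF U(1) bU] T'(1), of a r] nb U(2) T'(2) by simp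
    then show ?thesis using RDT.step[OF \<open>U \<in> RDT\<close> step.hyps(2) bU] by simp
  qed
qed

lemma RDT_cases_duplicate:
  assumes "T \<in> RDT"
  obtains "T = base_tree"
  | S a r where "S \<in> RDT" "1 \<le> r" "a + r \<le> num_leaves S" "T = duplicate a r S"
    "num_leaves T = num_leaves S + r"
  using assms
proof (cases rule: RDT.cases)
  case base
  then show thesis using that(1) by (simp only: base_tree_def)
next
  case (step S r a)
  then show thesis
    using that(2) num_leaves_duplicate[OF RDT_labelled_tree[OF step(2)] step(4)] by blast
qed

lemma RDT_num_leaves: 
  assumes "T \<in> RDT"
  shows "2 \<le> num_leaves T"
  using assms
proof (induction rule: RDT.induct)
  case base
  show ?case using num_leaves_base_tree by (simp only: base_tree_def)
next
  case (step T r a)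
  then show ?case using num_leaves_duplicate[OF RDT_labelled_tree[OF step.hyps(1)] step.hyps(3)] by simp
qed

lemma RDT_n_2: "RDT_n 2 = {base_tree}"
proof -
  have "T = base_tree" if T: "T \<in> RDT" "num_leaves T = 2" for T
    using T(1)
  proof (cases rule: RDT_cases_duplicate)
    case (2 S a r)
    then show ?thesis using RDT_num_leaves[OF 2(1)] T(2) by linarith
  qed
  then show ?thesis using base_tree_in_RDT num_leaves_base_tree by (auto simp: RDT_n_def)
qed

section \<open>One step of the canonical reduction\<close>

definition leftmost_run :: "nat \<Rightarrow> nat \<Rightarrow> tree \<Rightarrow> bool" where
  "leftmost_run a r T \<longleftrightarrow> cherry_run a r T \<and> (\<forall>b s. cherry_run b s T \<longrightarrow> b \<le> a)"

lemma leftmost_eqI: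
  assumes T: "labelled_tree T" and run: "leftmost_run a r T"
  shows "leftmost_a T = a" and "leftmost_r T = r"
proof -
  show a: "leftmost_a T = a"
    unfolding leftmost_a_def
    by (rule Greatest_equality) (use T run in \<open>auto simp: visible_duplication_iff_cherry_run leftmost_run_def\<close>)
  show "leftmost_r T = r"
    unfolding leftmost_r_def a
    by (rule the_equality)
      (use T run cherry_run_length_unique[OF T] in \<open>auto simp: visible_duplication_iff_cherry_run leftmost_run_def\<close>)
qed

lemma RDT_leftmost_run:
  assumes T: "T \<in> RDT" and "num_leaves T \<noteq> 2"
  obtains r where "leftmost_run (leftmost_a T) r T"
proof -
  let ?P = "\<lambda>a. \<exists>r. cherry_run a r T"
  from T obtain b where ex: "?P b"
  proof (cases rule: RDT_cases_duplicate)
    case 1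
    then show ?thesis using assms(2) num_leaves_base_tree by simp
  next
    case (2 S a r)
    then have "cherry_run a r T"
      using cherry_run_duplicate[OF RDT_labelled_tree[OF 2(1)] 2(2,3)] by simp
    then show ?thesis using that by blast
  qed
  have bound: "a \<le> num_leaves T" if "?P a" for a
    using that by (auto dest: cherry_run_bounds)
  from GreatestI_nat[of ?P, OF ex bound] obtain r where "cherry_run (Greatest ?P) r T" by blast
  moreover have "a \<le> Greatest ?P" if "?P a" for a
    using Greatest_le_nat[of ?P, OF that bound] .
  ultimately have "leftmost_run (Greatest ?P) r T" unfolding leftmost_run_def by blast
  then show thesis using that leftmost_eqI(1)[OF RDT_labelled_tree[OF T]] by metis
qed

lemma canonical_reduction_eq:
  assumes T: "labelled_tree T" "a + Suc r \<le> num_leaves T"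
    and run: "leftmost_run a (Suc r) (duplicate a (Suc r) T)"
  shows "canonical_reduction (duplicate a (Suc r) T) = duplicate (Suc a) r T"
  unfolding canonical_reduction_def leftmost_eqI[OF labelled_tree_duplicate[OF T] run]
  by (rule reduction_duplicate[OF T])

text \<open>The whole leftmost event can be undone inside \<open>RDT\<close>, and the canonical reduction is the first of
  the \<open>Suc r\<close> reductions that do so.\<close>

lemma RDT_canonical_parent:
  assumes T: "T \<in> RDT" and "num_leaves T \<noteq> 2"
  obtains r T' where "T' \<in> RDT" "leftmost_a T + Suc r \<le> num_leaves T'"
    "T = duplicate (leftmost_a T) (Suc r) T'"
    "leftmost_run (leftmost_a T) (Suc r) T"
    "canonical_reduction T = duplicate (Suc (leftmost_a T)) r T'"
proof -
  let ?a = "leftmost_a T"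
  obtain r' where run': "leftmost_run ?a r' T" using RDT_leftmost_run[OF assms] .
  then have cr: "cherry_run ?a r' T" by (simp add: leftmost_run_def)
  then obtain r where r: "r' = Suc r" using cherry_run_bounds[OF cr] by (cases r') auto
  obtain T' where T': "labelled_tree T'" "?a + Suc r \<le> num_leaves T'" "duplicate ?a (Suc r) T' = T"
    using cherry_run_obtains[OF RDT_labelled_tree[OF T] cr] unfolding r by metis
  have "T' \<in> RDT" by (rule duplicate_in_RDT_D[OF T T'(1) _ T'(2,3)]) simp
  moreover have "canonical_reduction T = duplicate (Suc ?a) r T'"
    using canonical_reduction_eq[OF T'(1,2)] run' unfolding r T'(3) by blast
  ultimately show thesis using that T' run' r by metis
qed

lemma duplicate_in_RDT: 
  assumes "T \<in> RDT" "a + r \<le> num_leaves T"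
  shows "duplicate a r T \<in> RDT"
  using assms RDT.step[of T r a] by (cases r) (auto simp: duplicate_0)

text \<open>The last claim is the inequality \<open>a\<^sub>k\<^sub>-\<^sub>1 \<le> a\<^sub>k + 1\<close>. An event further left in the reduced tree is
  disjoint from the shortened block, hence passes through the tree with that block undone to the
  unreduced tree, where it is visible further left than the leftmost event.\<close>

lemma canonical_reduction_RDT:
  assumes T: "T \<in> RDT" and "num_leaves T \<noteq> 2"
  shows "canonical_reduction T \<in> RDT" "Suc (num_leaves (canonical_reduction T)) = num_leaves T"
    "Suc (Suc (leftmost_a T)) \<le> num_leaves T"
    "cherry_run b s (canonical_reduction T) \<Longrightarrow> b \<le> Suc (leftmost_a T)"
proof -
  let ?a = "leftmost_a T"
  obtain r T' where T': "T' \<in> RDT" "?a + Suc r \<le> num_leaves T'"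
    "T = duplicate ?a (Suc r) T'" "leftmost_run ?a (Suc r) T"
    "canonical_reduction T = duplicate (Suc ?a) r T'"
    using RDT_canonical_parent[OF assms] .
  let ?S = "duplicate (Suc ?a) r T'"
  have l: "labelled_tree T'" by (rule RDT_labelled_tree[OF T'(1)])
  have b: "Suc ?a + r \<le> num_leaves T'" using T'(2) by simp
  have S: "labelled_tree ?S" by (rule labelled_tree_duplicate[OF l b])
  have nT: "num_leaves T = num_leaves T' + Suc r" using num_leaves_duplicate[OF l T'(2)] T'(3) by simp
  have nS: "num_leaves ?S = num_leaves T' + r" by (rule num_leaves_duplicate[OF l b])
  show "canonical_reduction T \<in> RDT" unfolding T'(5) by (rule duplicate_in_RDT[OF T'(1) b])
  show "Suc (num_leaves (canonical_reduction T)) = num_leaves T" by (simp add: T'(5) nT nS)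
  show "Suc (Suc ?a) \<le> num_leaves T" using nT T'(2) by linarith
  show "b \<le> Suc ?a" if run: "cherry_run b s (canonical_reduction T)" for b s
  proof (rule ccontr)
    assume "\<not> b \<le> Suc ?a"
    have run: "cherry_run b s ?S" using run by (simp add: T'(5))
    \<comment> \<open>For \<open>r = 0\<close> the whole event has been undone and there is no block to be disjoint from.\<close>
    have far: "Suc ?a + 2 * r \<le> b"
    proof (cases "r = 0")
      case False
      then have "cherry_run (Suc ?a) r ?S" using cherry_run_duplicate[OF l _ b] by simp
      from cherry_runs_disjoint[OF S run this] show ?thesis using \<open>\<not> b \<le> Suc ?a\<close> by simp
    qed (use \<open>\<not> b \<le> Suc ?a\<close> in simp)
    have far': "?a + 2 * Suc r \<le> Suc b" using far by simp
    have "cherry_run (b - r) s T'" using run cherry_run_duplicate_low_iff[OF l b far] by simp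
    then have "cherry_run (Suc b) s (duplicate ?a (Suc r) T')"
      using cherry_run_duplicate_low_iff[OF l T'(2) far'] by simp
    then have "Suc b \<le> ?a" using T'(3,4) unfolding leftmost_run_def by metis
    then show False using \<open>\<not> b \<le> Suc ?a\<close> by simp
  qed
qed

text \<open>If \<open>S\<close> shows an event with parameter \<open>a + 1\<close>, it must be lengthened to the right by one leaf;
  otherwise a single leaf of \<open>S\<close> is duplicated. An event of the new tree left of the new block is
  inherited from \<open>S\<close>, where the bound on its parameter leaves only the value \<open>a + 1\<close> for \<open>r = 0\<close>,
  which is the case excluded by the choice of \<open>r\<close>.\<close>

lemma canonical_reduction_surj:
  assumes S: "S \<in> RDT" and a: "Suc a \<le> num_leaves S"
    and le: "\<And>b s. cherry_run b s S \<Longrightarrow> b \<le> Suc a"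
  shows "\<exists>T\<in>RDT. num_leaves T = Suc (num_leaves S) \<and> leftmost_a T = a \<and> canonical_reduction T = S"
proof -
  have lS: "labelled_tree S" by (rule RDT_labelled_tree[OF S])
  obtain r T' where T': "T' \<in> RDT" "Suc a + r \<le> num_leaves T'" "duplicate (Suc a) r T' = S"
    and r: "r = 0 \<Longrightarrow> \<nexists>s. cherry_run (Suc a) s S"
  proof (cases "\<exists>r. cherry_run (Suc a) r S")
    case True
    then obtain r where run: "cherry_run (Suc a) r S" ..
    obtain T' where T': "labelled_tree T'" "Suc a + r \<le> num_leaves T'" "duplicate (Suc a) r T' = S"
      using cherry_run_obtains[OF lS run] .
    have "1 \<le> r" using cherry_run_bounds[OF run] by simp
    have "T' \<in> RDT" by (rule duplicate_in_RDT_D[OF S T'(1) \<open>1 \<le> r\<close> T'(2,3)])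
    then show thesis using that T' \<open>1 \<le> r\<close> by (metis not_one_le_zero)
  next
    case False
    show thesis by (rule that[of S 0]) (use S a False in \<open>auto simp: duplicate_0\<close>)
  qed
  define T where "T = duplicate a (Suc r) T'"
  have l: "labelled_tree T'" by (rule RDT_labelled_tree[OF T'(1)])
  have b: "a + Suc r \<le> num_leaves T'" using T'(2) by simp
  have lT: "labelled_tree T" unfolding T_def by (rule labelled_tree_duplicate[OF l b])
  have nS: "num_leaves S = num_leaves T' + r" using num_leaves_duplicate[OF l T'(2)] T'(3) by simp
  have nT: "num_leaves T = num_leaves T' + Suc r" unfolding T_def by (rule num_leaves_duplicate[OF l b])
  have runT: "cherry_run a (Suc r) T" unfolding T_def by (rule cherry_run_duplicate[OF l _ b]) simp
  have "c \<le> a" if run: "cherry_run c s T" for c s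
  proof (rule ccontr)
    assume "\<not> c \<le> a"
    then have far: "a + 2 * Suc r \<le> c" using cherry_runs_disjoint[OF lT run runT] by simp
    have far': "Suc a + 2 * r \<le> c - 1" using far by simp
    have "cherry_run (c - Suc r) s T'"
      using run cherry_run_duplicate_low_iff[OF l b far] by (simp add: T_def)
    then have runS: "cherry_run (c - 1) s S"
      using cherry_run_duplicate_low_iff[OF l T'(2) far'] T'(3) by simp
    from le[OF this] have "r = 0" "c - 1 = Suc a" using far by simp_all
    then show False using r runS by auto
  qed
  then have lm: "leftmost_run a (Suc r) T" using runT by (auto simp: leftmost_run_def)
  have "T \<in> RDT" unfolding T_def by (rule duplicate_in_RDT[OF T'(1) b])
  moreover have "canonical_reduction T = S"
    using canonical_reduction_eq[OF l b] lm T'(3) by (simp add: T_def)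
  ultimately show ?thesis using leftmost_eqI(1)[OF lT lm] nS nT by auto
qed

text \<open>The two ways of going back from \<open>S\<close> exclude each other: duplicating a single leaf of a tree that
  shows an event with parameter \<open>a + 1\<close> yields a tree in which this event has parameter \<open>a + 2\<close>,
  so that \<open>a\<close> is not leftmost.\<close>

lemma canonical_reduction_inj:
  assumes T1: "T1 \<in> RDT" "num_leaves T1 \<noteq> 2" and T2: "T2 \<in> RDT" "num_leaves T2 \<noteq> 2"
    and a: "leftmost_a T1 = leftmost_a T2" and S: "canonical_reduction T1 = canonical_reduction T2"
  shows "T1 = T2"
proof -
  define a where "a = leftmost_a T1"
  have a': "leftmost_a T1 = a" "leftmost_a T2 = a" using a by (auto simp: a_def)
  obtain r1 U1 where U1: "U1 \<in> RDT" "a + Suc r1 \<le> num_leaves U1" "T1 = duplicate a (Suc r1) U1"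
    "leftmost_run a (Suc r1) T1" "canonical_reduction T1 = duplicate (Suc a) r1 U1"
    using RDT_canonical_parent[OF T1] unfolding a' .
  obtain r2 U2 where U2: "U2 \<in> RDT" "a + Suc r2 \<le> num_leaves U2" "T2 = duplicate a (Suc r2) U2"
    "leftmost_run a (Suc r2) T2" "canonical_reduction T2 = duplicate (Suc a) r2 U2"
    using RDT_canonical_parent[OF T2] unfolding a' .
  note l1 = RDT_labelled_tree[OF U1(1)] and l2 = RDT_labelled_tree[OF U2(1)]
  have eq: "duplicate (Suc a) r1 U1 = duplicate (Suc a) r2 U2" using S U1(5) U2(5) by simp
  have no: "\<not> cherry_run (Suc a) s U" 
    if "labelled_tree U" "a + 1 \<le> num_leaves U" "leftmost_run a 1 (duplicate a 1 U)" for U s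
  proof
    assume "cherry_run (Suc a) s U"
    then have "cherry_run (a + 2) s (duplicate a 1 U)"
      using cherry_run_duplicate_low_iff[OF that(1,2), of "a + 2"] by simp
    then have "a + 2 \<le> a" using that(3) unfolding leftmost_run_def by blast
    then show False by simp
  qed
  have r0: False if "labelled_tree U" "a + 1 \<le> num_leaves U" "leftmost_run a (Suc 0) (duplicate a (Suc 0) U)"
    "U = duplicate (Suc a) r V" "r \<noteq> 0" "labelled_tree V" "Suc a + r \<le> num_leaves V" for U V r
    using no[OF that(1,2)] that(3-7) cherry_run_duplicate[of V r "Suc a"] by auto
  have "r1 = r2"
  proof (cases "r1 = 0 \<or> r2 = 0")
    case True
    have "r2 = 0" if "r1 = 0"
    proof (rule ccontr)
      assume "r2 \<noteq> 0"
      have "U1 = duplicate (Suc a) r2 U2" using eq that by (simp add: duplicate_0)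
      then show False using r0[OF l1 _ _ _ \<open>r2 \<noteq> 0\<close> l2] U1(2,3,4) U2(2) that by simp
    qed
    moreover have "r1 = 0" if "r2 = 0"
    proof (rule ccontr)
      assume "r1 \<noteq> 0"
      have "U2 = duplicate (Suc a) r1 U1" using eq that by (simp add: duplicate_0)
      then show False using r0[OF l2 _ _ _ \<open>r1 \<noteq> 0\<close> l1] U2(2,3,4) U1(2) that by simp
    qed
    ultimately show ?thesis using True by auto
  next
    case False
    have "cherry_run (Suc a) r1 (duplicate (Suc a) r1 U1)"
      using cherry_run_duplicate[OF l1] False U1(2) by simp
    moreover have "cherry_run (Suc a) r2 (duplicate (Suc a) r1 U1)"
      unfolding eq using cherry_run_duplicate[OF l2] False U2(2) by simp
    moreover have "labelled_tree (duplicate (Suc a) r1 U1)"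
      using labelled_tree_duplicate[OF l1] U1(2) by simp
    ultimately show ?thesis using cherry_run_length_unique by blast
  qed
  moreover from this have "U1 = U2"
    using duplicate_inject[OF l1 l2, of "Suc a" r1] U1(2) U2(2) eq by simp
  ultimately show ?thesis using U1(3) U2(3) by simp
qed

section \<open>The sequences\<close>

text \<open>All indices of a 2-increasing sequence are 2-ascents, so that \<open>a\<^sub>k\<^sub>+\<^sub>1\<close> is bounded by \<open>k\<close>.\<close>

lemma tI_iff:
  "xs \<in> tI N \<longleftrightarrow> length xs = N \<and> xs \<noteq> [] \<and> xs ! 0 = 0 \<and>
     (\<forall>k. 1 \<le> k \<and> k < N \<longrightarrow> xs ! k \<le> k \<and> xs ! (k - 1) \<le> Suc (xs ! k))"
proof -
  have inc: "two_increasing xs \<longleftrightarrow> (\<forall>k. 1 \<le> k \<and> k < length xs \<longrightarrow> xs ! (k - 1) \<le> Suc (xs ! k))"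
    by (auto simp: two_increasing_def is_2_ascent_def)
  have asc: "num_2_ascents (take k xs) = k - 1" if "two_increasing xs" "k < length xs" for k
  proof -
    have "{j. is_2_ascent (take k xs) j} = {1..<k}"
      using that by (auto simp: two_increasing_def is_2_ascent_def)
    then show ?thesis by (simp add: num_2_ascents_def)
  qed
  show ?thesis
  proof (cases "two_increasing xs")
    case True
    then show ?thesis using inc asc by (auto simp: tI_def two_ascent_sequence_def)
  next
    case False
    then show ?thesis using inc by (auto simp: tI_def)
  qed
qed

lemma snoc_tI_iff:
  assumes "1 \<le> N"
  shows "xs @ [a] \<in> tI (Suc N) \<longleftrightarrow> xs \<in> tI N \<and> a \<le> N \<and> last xs \<le> Suc a"
proof (cases "length xs = N")
  case True
  with assms have ne: "xs \<noteq> []" by auto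
  have split: "(\<forall>k. 1 \<le> k \<and> k < Suc N \<longrightarrow> P k) \<longleftrightarrow> (\<forall>k. 1 \<le> k \<and> k < N \<longrightarrow> P k) \<and> P N" for P
    using assms by (auto simp: less_Suc_eq)
  have "(\<forall>k. 1 \<le> k \<and> k < N \<longrightarrow> (xs @ [a]) ! k \<le> k \<and> (xs @ [a]) ! (k - 1) \<le> Suc ((xs @ [a]) ! k))
    \<longleftrightarrow> (\<forall>k. 1 \<le> k \<and> k < N \<longrightarrow> xs ! k \<le> k \<and> xs ! (k - 1) \<le> Suc (xs ! k))"
    using True by (auto simp: nth_append)
  moreover have "(xs @ [a]) ! N = a" "(xs @ [a]) ! (N - 1) = last xs" "(xs @ [a]) ! 0 = xs ! 0"
    using True ne by (auto simp: nth_append last_conv_nth)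
  ultimately show ?thesis unfolding tI_iff split using True ne by simp
qed (auto simp: tI_iff)

text \<open>The canonical histories of a tree and of its canonical reduction agree below the top.\<close>

lemma canonical_reduction_sequence_snoc:
  assumes "T \<in> RDT" and "num_leaves T \<noteq> 2"
  shows "canonical_reduction_sequence T = canonical_reduction_sequence (canonical_reduction T) @ [leftmost_a T]"
proof -
  let ?S = "canonical_reduction T" and ?n = "num_leaves (canonical_reduction T)"
  have n: "num_leaves T = Suc ?n" using canonical_reduction_RDT(2)[OF assms] by simp
  have "2 \<le> ?n" by (rule RDT_num_leaves[OF canonical_reduction_RDT(1)[OF assms]])
  have "canonical_history T k = canonical_history ?S k" if "k \<le> ?n" for k
    using that by (simp add: canonical_history_def n Suc_diff_le funpow_swap1)
  then have "map (\<lambda>k. if k = 2 then 0 else leftmost_a (canonical_history T k)) [2..<Suc ?n] =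
      canonical_reduction_sequence ?S"
    unfolding canonical_reduction_sequence_def by (intro map_cong) auto
  moreover have "canonical_history T (Suc ?n) = T" by (simp add: canonical_history_def n)
  ultimately show ?thesis
    using \<open>2 \<le> ?n\<close> by (simp add: canonical_reduction_sequence_def[of T] n)
qed

lemma canonical_reduction_sequence_base:
  "canonical_reduction_sequence base_tree = [0]"
  by (simp add: canonical_reduction_sequence_def num_leaves_base_tree upt_rec)

text \<open>The value \<open>0\<close> that the sequence assigns to the initial tree fits the general rule, because that
  tree has no visible event and the right-hand side is then true.\<close>

lemma last_canonical_reduction_sequence_le_iff:
  assumes "T \<in> RDT"
  shows "last (canonical_reduction_sequence T) \<le> c \<longleftrightarrow> (\<forall>b s. cherry_run b s T \<longrightarrow> b \<le> c)"
proof (cases "num_leaves T = 2")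
  case True
  then have "T = base_tree" using assms RDT_n_2 by (auto simp: RDT_n_def)
  then show ?thesis using not_cherry_run_base_tree canonical_reduction_sequence_base by simp
next
  case False
  obtain r where "leftmost_run (leftmost_a T) r T" using RDT_leftmost_run[OF assms False] .
  then show ?thesis
    unfolding canonical_reduction_sequence_snoc[OF assms False] leftmost_run_def
    by (auto intro: order_trans)
qed

theorem theorem6p3:
  fixes n :: nat
  assumes "n \<ge> 2"
  shows "bij_betw canonical_reduction_sequence (RDT_n n) (tI (n - 1))"
  using assms
proof (induction n rule: dec_induct)
  case base
  have "tI 1 = {[0]}"
    by (auto simp: tI_iff length_Suc_conv)
  then show ?case
    by (simp add: RDT_n_2 canonical_reduction_sequence_base bij_betw_def)
next
  case (step n)
  let ?\<alpha> = canonical_reduction_sequence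
  have red: "canonical_reduction T \<in> RDT_n n" "T \<in> RDT" "num_leaves T \<noteq> 2"
    "?\<alpha> T = ?\<alpha> (canonical_reduction T) @ [leftmost_a T]" if "T \<in> RDT_n (Suc n)" for T
    using that step.hyps canonical_reduction_RDT[of T] canonical_reduction_sequence_snoc[of T]
    by (auto simp: RDT_n_def)
  have snoc: "xs @ [a] \<in> tI n \<longleftrightarrow> xs \<in> tI (n - 1) \<and> Suc a \<le> n \<and> last xs \<le> Suc a" for xs a
    using snoc_tI_iff[of "n - 1" xs a] step.hyps by auto
  have inj: "inj_on ?\<alpha> (RDT_n (Suc n))"
  proof (rule inj_onI)
    fix T1 T2 assume T: "T1 \<in> RDT_n (Suc n)" "T2 \<in> RDT_n (Suc n)" "?\<alpha> T1 = ?\<alpha> T2"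
    then have "leftmost_a T1 = leftmost_a T2"
      "?\<alpha> (canonical_reduction T1) = ?\<alpha> (canonical_reduction T2)" by (auto simp: red(4))
    moreover from this have "canonical_reduction T1 = canonical_reduction T2"
      using step.IH red(1) T(1,2) by (auto simp: bij_betw_def dest: inj_onD)
    ultimately show "T1 = T2" using canonical_reduction_inj red(2,3) T(1,2) by blast
  qed
  have into: "?\<alpha> T \<in> tI n" if T: "T \<in> RDT_n (Suc n)" for T
  proof -
    let ?S = "canonical_reduction T"
    have "?\<alpha> ?S \<in> tI (n - 1)" using step.IH red(1)[OF T] by (auto simp: bij_betw_def)
    moreover have "last (?\<alpha> ?S) \<le> Suc (leftmost_a T)"
      using last_canonical_reduction_sequence_le_iff canonical_reduction_RDT(1,4) red(2,3)[OF T] by blast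
    moreover have "Suc (leftmost_a T) \<le> n"
      using canonical_reduction_RDT(3)[OF red(2,3)[OF T]] T by (simp add: RDT_n_def)
    ultimately show ?thesis unfolding red(4)[OF T] snoc by blast
  qed
  have onto: "xs \<in> ?\<alpha> ` RDT_n (Suc n)" if xs: "xs \<in> tI n" for xs
  proof -
    obtain ys a where ys: "xs = ys @ [a]" using xs by (cases xs rule: rev_cases) (auto simp: tI_iff)
    with xs snoc have ys': "ys \<in> tI (n - 1)" "Suc a \<le> n" "last ys \<le> Suc a" by auto
    have "ys \<in> ?\<alpha> ` RDT_n n" using bij_betw_imp_surj_on[OF step.IH] ys'(1) by simp
    then obtain S where S: "S \<in> RDT_n n" "?\<alpha> S = ys" by blast
    then have S': "S \<in> RDT" "num_leaves S = n" by (auto simp: RDT_n_def)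
    have "\<And>b s. cherry_run b s S \<Longrightarrow> b \<le> Suc a"
      using last_canonical_reduction_sequence_le_iff[OF S'(1)] \<open>last ys \<le> Suc a\<close> S(2) by blast
    then obtain T where T: "T \<in> RDT" "num_leaves T = Suc n" "leftmost_a T = a" "canonical_reduction T = S"
      using canonical_reduction_surj[OF S'(1), of a] \<open>Suc a \<le> n\<close> S'(2) by auto
    then have "T \<in> RDT_n (Suc n)" by (simp add: RDT_n_def)
    moreover from red(4)[OF this] have "?\<alpha> T = xs" using T S ys by simp
    ultimately show ?thesis by blast
  qed
  show ?case using inj into onto by (auto simp: bij_betw_def)
qed

end
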